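(* Let $r \ge 3$. Then for every $n \ge 1$, $\omega^{\mathrm{DHJ}}_r(n) \le \omega_{\overline{Q}_r}(n)$.
   Context: Combinatorial lines: a combinatorial pattern over $[r]^n$ is a string $\underline{b} \in ([r]\cup\{\star\})^n \setminus [r]^n$ ($\star$ a wildcard). For $q\in[r]$, $\underline{b}(q)$ is obtained by replacing every $\star$ by $q$; the combinatorial line is $L(\underline{b})=\{\underline{b}(1),\dots,\underline{b}(r)\}$. For $S\subseteq[r]^n$, $\mu(S)=|S|/r^n$. $\omega^{\mathrm{DHJ}}_r(n)$ is the maximum of $\mu(S)$ over all $S\subseteq[r]^n$ containing no combinatorial line. Games: an $r$-prover question set is a finite nonempty $\overline{Q}\subseteq Q^{(1)}\times\cdots\times Q^{(r)}$ with finite $Q^{(j)}$ such that every element of each $Q^{(j)}$ occurs as a $j$-th coordinate of some tuple of $\overline{Q}$. An $r$-prover game with question set $\overline{Q}$ is $(\overline{Q},\overline{A},V)$ with $\overline{A}=A^{(1)}\times\cdots\times A^{(r)}$ a product of finite alphabets and $V:\overline{Q}\times\overline{A}\to\{0,1\}$. A strategy is $(\mathcal{S}^{(1)},\dots,\mathcal{S}^{(r)})$, $\mathcal{S}^{(j)}:Q^{(j)}\to A^{(j)}$; the value is the maximum over strategies of the probability, over $\overline{q}$ uniform on $\overline{Q}$, that $V(\overline{q},\mathcal{S}^{(1)}(q^{(1)}),\dots,\mathcal{S}^{(r)}(q^{(r)}))=1$. A game is trivial if its value is $1$. The $n$-fold parallel repetition $\mathcal{G}^n$ has question set $\overline{Q}^n$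 (prover $j$ gets the $n$ $j$-th coordinates), answer alphabets $(A^{(j)})^n$, and accepts iff $V$ accepts in all $n$ coordinates. $\omega_{\overline{Q}}(n)$ is the supremum of $\mathrm{val}(\mathcal{G}^n)$ over all non-trivial games $\mathcal{G}$ with question set $\overline{Q}$ (with arbitrary finite answer alphabets). $\overline{Q}_r$: $Q^{(j)}=\{0,1\}$ for all $j$, and $\overline{Q}_r=\{(q^{(1)},\dots,q^{(r)})\in\{0,1\}^r: \text{exactly one } q^{(j)} \text{ equals } 1\}$. *)

theory Defs
  imports "HOL-Probability.Probability_Mass_Function" "HOL-Library.FuncSet"
begin

section \<open>Combinatorial lines\<close>

text \<open>
  Tuples indexed by \<open>[k] = {1..k}\<close> are extensional functions on \<open>{1..k}\<close>.
  A pattern is a word over \<open>[r]\<close> extended by the wildcard \<^const>\<open>None\<close>.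
\<close>

definition words :: "nat \<Rightarrow> nat \<Rightarrow> (nat \<Rightarrow> nat) set" where
  "words r n = PiE {1..n} (\<lambda>_. {1..r})"

definition patterns :: "nat \<Rightarrow> nat \<Rightarrow> (nat \<Rightarrow> nat option) set" where
  "patterns r n =
     PiE {1..n} (\<lambda>_. insert None (Some ` {1..r})) - PiE {1..n} (\<lambda>_. Some ` {1..r})"

definition fill :: "nat \<Rightarrow> (nat \<Rightarrow> nat option) \<Rightarrow> nat \<Rightarrow> (nat \<Rightarrow> nat)" where
  "fill n b q = (\<lambda>i\<in>{1..n}. case b i of None \<Rightarrow> q | Some a \<Rightarrow> a)"

definition comb_line :: "nat \<Rightarrow> nat \<Rightarrow> (nat \<Rightarrow> nat option) \<Rightarrow> (nat \<Rightarrow> nat) set" where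
  "comb_line r n b = fill n b ` {1..r}"

definition line_free :: "nat \<Rightarrow> nat \<Rightarrow> (nat \<Rightarrow> nat) set \<Rightarrow> bool" where
  "line_free r n S \<longleftrightarrow> \<not> (\<exists>b \<in> patterns r n. comb_line r n b \<subseteq> S)"

definition word_density :: "nat \<Rightarrow> nat \<Rightarrow> (nat \<Rightarrow> nat) set \<Rightarrow> real" where
  "word_density r n S = real (card S) / real r ^ n"

definition omega_DHJ :: "nat \<Rightarrow> nat \<Rightarrow> real" where
  "omega_DHJ r n = Max {word_density r n S | S. S \<subseteq> words r n \<and> line_free r n S}"


section \<open>Multi-prover games\<close>

record 'q question_set =
  provers :: nat
  questions :: "nat \<Rightarrow> 'q set"
  qtuples :: "(nat \<Rightarrow> 'q) set"

definition valid_question_set :: "'q question_set \<Rightarrow> bool" where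
  "valid_question_set Q \<longleftrightarrow>
     (\<forall>j\<in>{1..provers Q}. finite (questions Q j)) \<and>
     qtuples Q \<subseteq> PiE {1..provers Q} (questions Q) \<and>
     finite (qtuples Q) \<and> qtuples Q \<noteq> {} \<and>
     (\<forall>j\<in>{1..provers Q}. \<forall>x\<in>questions Q j. \<exists>q\<in>qtuples Q. q j = x)"

record ('q, 'a) game =
  qset :: "'q question_set"
  answers :: "nat \<Rightarrow> 'a set"
  verdict :: "(nat \<Rightarrow> 'q) \<Rightarrow> (nat \<Rightarrow> 'a) \<Rightarrow> bool"

text \<open>
  Alphabets are nonempty, so that strategies exist and the maximum defining the value is
  attained. The predicate \<open>verdict\<close> is only ever evaluated on question tuples from
  \<open>qtuples\<close> and answer tuples from the product of the alphabets.
\<close>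

definition valid_game :: "('q, 'a) game \<Rightarrow> bool" where
  "valid_game G \<longleftrightarrow>
     valid_question_set (qset G) \<and>
     (\<forall>j\<in>{1..provers (qset G)}. finite (answers G j) \<and> answers G j \<noteq> {})"

definition strategies :: "('q, 'a) game \<Rightarrow> (nat \<Rightarrow> 'q \<Rightarrow> 'a) set" where
  "strategies G =
     PiE {1..provers (qset G)} (\<lambda>j. PiE (questions (qset G) j) (\<lambda>_. answers G j))"

definition success_prob :: "('q, 'a) game \<Rightarrow> (nat \<Rightarrow> 'q \<Rightarrow> 'a) \<Rightarrow> real" where
  "success_prob G S =
     measure_pmf.prob (pmf_of_set (qtuples (qset G)))
       {q. verdict G q (\<lambda>j\<in>{1..provers (qset G)}. S j (q j))}"

definition game_value :: "('q, 'a) game \<Rightarrow> real" where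
  "game_value G = Max (success_prob G ` strategies G)"

definition trivial_game :: "('q, 'a) game \<Rightarrow> bool" where
  "trivial_game G \<longleftrightarrow> game_value G = 1"


section \<open>Parallel repetition\<close>

text \<open>
  An element \<open>t\<close> of the \<open>n\<close>-th power of the set of question tuples has entries \<open>t i j\<close>
  (coordinate \<open>i\<close>, prover \<open>j\<close>). As a question tuple of the repeated game it is transposed:
  its \<open>j\<close>-th component is the \<open>n\<close>-tuple of the \<open>j\<close>-th coordinates.
\<close>

definition power_question_set :: "'q question_set \<Rightarrow> nat \<Rightarrow> (nat \<Rightarrow> 'q) question_set" where
  "power_question_set Q n =
     \<lparr> provers = provers Q,
       questions = (\<lambda>j. PiE {1..n} (\<lambda>_. questions Q j)),
       qtuples = (\<lambda>t. \<lambda>j\<in>{1..provers Q}. \<lambda>i\<in>{1..n}. t i j) ` PiE {1..n} (\<lambda>_. qtuples Q) \<rparr>"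

definition parallel_repetition ::
    "('q, 'a) game \<Rightarrow> nat \<Rightarrow> (nat \<Rightarrow> 'q, nat \<Rightarrow> 'a) game" where
  "parallel_repetition G n =
     \<lparr> qset = power_question_set (qset G) n,
       answers = (\<lambda>j. PiE {1..n} (\<lambda>_. answers G j)),
       verdict = (\<lambda>q a. \<forall>i\<in>{1..n}.
         verdict G (\<lambda>j\<in>{1..provers (qset G)}. q j i) (\<lambda>j\<in>{1..provers (qset G)}. a j i)) \<rparr>"

text \<open>
  The supremum ranges over all finite answer alphabets; since values are invariant under
  renaming answers, it suffices to take alphabets that are finite sets of natural numbers.
\<close>

definition omega_rep :: "'q question_set \<Rightarrow> nat \<Rightarrow> real" where
  "omega_rep Q n =
     Sup {game_value (parallel_repetition G n) | G :: ('q, nat) game.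
            valid_game G \<and> qset G = Q \<and> \<not> trivial_game G}"


section \<open>The question set with exactly one 1\<close>

definition one_hot_questions :: "nat \<Rightarrow> nat question_set" where
  "one_hot_questions r =
     \<lparr> provers = r,
       questions = (\<lambda>_. {0, 1}),
       qtuples = {q \<in> PiE {1..r} (\<lambda>_. {0, 1}). \<exists>!j. j \<in> {1..r} \<and> q j = 1} \<rparr>"

lemma valid_one_hot_questions:
  assumes "r \<ge> 2"
  shows "valid_question_set (one_hot_questions r)"
proof -
  let ?T = "{q \<in> PiE {1..r} (\<lambda>_. {0, 1::nat}). \<exists>!j. j \<in> {1..r} \<and> q j = 1}"
  define e :: "nat \<Rightarrow> nat \<Rightarrow> nat" where "e k = (\<lambda>j\<in>{1..r}. if j = k then 1 else 0)" for k
  have e: "e k \<in> ?T" if "k \<in> {1..r}" for k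
    using that by (auto simp: e_def)
  have "\<exists>q\<in>?T. q j = x" if j: "j \<in> {1..r}" and x: "x \<in> {0, 1}" for j x
  proof (cases "x = 1")
    case True
    then show ?thesis using e[OF j] j by (intro bexI[of _ "e j"]) (auto simp: e_def)
  next
    case False
    define k where "k = (if j = 1 then 2 else 1 :: nat)"
    have "k \<in> {1..r}" "k \<noteq> j" using assms by (auto simp: k_def)
    then show ?thesis using e[of k] j x False by (intro bexI[of _ "e k"]) (auto simp: e_def)
  qed
  moreover have "finite ?T"
    by (rule finite_subset[of _ "PiE {1..r} (\<lambda>_. {0, 1})"]) (auto intro: finite_PiE)
  moreover have "?T \<noteq> {}" using e[of 1] assms by auto
  ultimately show ?thesis
    unfolding valid_question_set_def one_hot_questions_def by simp
qed

end

theory Submission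
  imports Defs "HOL-Library.Nat_Bijection"
begin

text \<open>
  A tuple of \<open>Q\<^sub>r\<^sup>n\<close> is a word \<open>w\<close> over \<open>[r]\<close>, and prover \<open>j\<close> sees the set of positions carrying
  the letter \<open>j\<close>. For a line-free \<open>S\<close>, consider the game in which every prover answers with a pair
  \<open>(i, X)\<close> of a coordinate and a set of positions, and the verifier accepts iff all provers name
  the same \<open>i\<close>, the sets are the level sets of some \<open>w \<in> S\<close>, and the question is the \<open>i\<close>-th
  letter of \<open>w\<close>. In the repeated game the provers answer coordinate \<open>i\<close> with \<open>i\<close> and all that they see,
  and win on every word of \<open>S\<close>. A perfect strategy for a single copy gives words \<open>w\<^sub>1, \<dots>, w\<^sub>r \<in> S\<close>, one for
  each question; as the answers to \<open>0\<close> do not depend on the question tuple, these words form a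
  combinatorial line, with an active coordinate at the named \<open>i\<close>.
\<close>

section \<open>The game attached to a set of words\<close>

text \<open>Packed into one natural number because \<open>omega_rep\<close> ranges over games with
  answers in \<open>nat\<close>. Cutting down to \<open>{1..n}\<close> makes the set finite, where
  \<open>set_encode\<close> is injective, so whole level sets \<open>{m. w m = j}\<close> can be
  passed in.\<close>

definition level_answer :: "nat \<Rightarrow> nat \<Rightarrow> nat set \<Rightarrow> nat" where
  "level_answer n i X = prod_encode (i, set_encode (X \<inter> {1..n}))"

lemma level_answer_eq_iff:
  "level_answer n i X = level_answer n i' X' \<longleftrightarrow> i = i' \<and> X \<inter> {1..n} = X' \<inter> {1..n}"
  by (simp add: level_answer_def prod_encode_eq set_encode_eq)

text \<open>A single copy already depends on \<open>n\<close>: its answers speak of a whole word of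
  length \<open>n\<close>, while its question reveals only one letter of that word.\<close>

definition line_game :: "nat \<Rightarrow> nat \<Rightarrow> (nat \<Rightarrow> nat) set \<Rightarrow> (nat, nat) game" where
  "line_game r n S =
     \<lparr> qset = one_hot_questions r,
       answers = (\<lambda>_. (\<lambda>(i, X). level_answer n i X) ` ({1..n} \<times> Pow {1..n})),
       verdict = (\<lambda>q a. \<exists>w\<in>S. \<exists>i\<in>{1..n}. \<forall>j\<in>{1..r}.
          a j = level_answer n i {m. w m = j} \<and> (q j = 1 \<longleftrightarrow> w i = j)) \<rparr>"

lemma line_game_simps [simp]:
  "qset (line_game r n S) = one_hot_questions r"
  "answers (line_game r n S) j = (\<lambda>(i, X). level_answer n i X) ` ({1..n} \<times> Pow {1..n})"
  "verdict (line_game r n S) q a \<longleftrightarrow> (\<exists>w\<in>S. \<exists>i\<in>{1..n}. \<forall>j\<in>{1..r}.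
          a j = level_answer n i {m. w m = j} \<and> (q j = 1 \<longleftrightarrow> w i = j))"
  by (simp_all add: line_game_def)

lemma one_hot_simps [simp]:
  "provers (one_hot_questions r) = r"
  "questions (one_hot_questions r) j = {0, 1}"
  by (simp_all add: one_hot_questions_def)

lemma valid_line_game:
  assumes "r \<ge> 2" "n \<ge> 1"
  shows "valid_game (line_game r n S)"
  using assms valid_one_hot_questions[of r] by (auto simp: valid_game_def)

section \<open>Question tuples as letters, repeated question tuples as words\<close>

definition one_hot :: "nat \<Rightarrow> nat \<Rightarrow> nat \<Rightarrow> nat" where
  "one_hot r k = (\<lambda>j\<in>{1..r}. if j = k then 1 else 0)"

lemma qtuples_one_hot: "qtuples (one_hot_questions r) = one_hot r ` {1..r}"
proof (intro equalityI subsetI)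
  fix q assume "q \<in> qtuples (one_hot_questions r)"
  then have q: "q \<in> PiE {1..r} (\<lambda>_. {0, 1})" and "\<exists>!j. j \<in> {1..r} \<and> q j = 1"
    by (auto simp: one_hot_questions_def)
  then obtain k where k: "k \<in> {1..r}" "\<And>j. j \<in> {1..r} \<Longrightarrow> q j = 1 \<longleftrightarrow> j = k" by auto
  have "q = one_hot r k"
  proof
    fix j show "q j = one_hot r k j"
      using q k PiE_mem[OF q, of j] PiE_arb[OF q, of j] by (auto simp: one_hot_def)
  qed
  with k show "q \<in> one_hot r ` {1..r}" by auto
next
  fix q assume "q \<in> one_hot r ` {1..r}"
  then obtain k where k: "k \<in> {1..r}" and q: "q = one_hot r k" by blast
  have "q \<in> PiE {1..r} (\<lambda>_. {0, 1})" by (simp add: q one_hot_def restrict_PiE_iff)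
  moreover have "j \<in> {1..r} \<and> q j = 1 \<longleftrightarrow> j = k" for j
    using k by (auto simp: q one_hot_def)
  ultimately show "q \<in> qtuples (one_hot_questions r)"
    by (simp add: one_hot_questions_def)
qed

definition word_question :: "nat \<Rightarrow> nat \<Rightarrow> (nat \<Rightarrow> nat) \<Rightarrow> nat \<Rightarrow> nat \<Rightarrow> nat" where
  "word_question r n w = (\<lambda>j\<in>{1..r}. \<lambda>i\<in>{1..n}. if w i = j then 1 else 0)"

text \<open>Turns the uniform distribution on repeated questions into density among words. A
  question tuple is determined by the prover who receives 1, so choosing one per coordinate spells a
  word.\<close>

lemma bij_betw_word_question:
  "bij_betw (word_question r n) (words r n) (qtuples (power_question_set (one_hot_questions r) n))"
proof (rule bij_betw_imageI)
  show "inj_on (word_question r n) (words r n)"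
  proof (rule inj_onI)
    fix v w assume v: "v \<in> words r n" and w: "w \<in> words r n"
      and eq: "word_question r n v = word_question r n w"
    have "v i = w i" if i: "i \<in> {1..n}" for i
    proof -
      have "v i \<in> {1..r}" using v i by (auto simp: words_def)
      \<comment> \<open>Prover \<open>v i\<close> receives 1 in coordinate \<open>i\<close> under
        \<open>v\<close>, hence also under \<open>w\<close>, which forces
        \<open>w i = v i\<close>.\<close>
      then show ?thesis
        using fun_cong[OF fun_cong[OF eq, of "v i"], of i] i
        by (auto simp: word_question_def split: if_splits)
    qed
    with v w show "v = w" unfolding words_def by (intro PiE_ext) auto
  qed
next
  let ?tr = "\<lambda>t. \<lambda>j\<in>{1..r}. \<lambda>i\<in>{1..n}. t i j :: nat"
  have qt: "qtuples (power_question_set (one_hot_questions r) n)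
      = ?tr ` PiE {1..n} (\<lambda>_. one_hot r ` {1..r})"
    by (simp add: power_question_set_def qtuples_one_hot)
  have tr: "?tr (\<lambda>i\<in>{1..n}. one_hot r (w i)) = word_question r n w" for w
    by (auto simp: word_question_def one_hot_def fun_eq_iff restrict_def)
  show "word_question r n ` words r n = qtuples (power_question_set (one_hot_questions r) n)"
    unfolding qt
  proof (intro equalityI subsetI)
    fix x assume "x \<in> word_question r n ` words r n"
    then obtain w where w: "w \<in> words r n" "x = word_question r n w" by auto
    have "(\<lambda>i\<in>{1..n}. one_hot r (w i)) \<in> PiE {1..n} (\<lambda>_. one_hot r ` {1..r})"
      using w by (auto simp: words_def)
    then show "x \<in> ?tr ` PiE {1..n} (\<lambda>_. one_hot r ` {1..r})"
      unfolding w(2) by (rule image_eqI[of _ ?tr, OF tr[symmetric]])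
  next
    fix x assume "x \<in> ?tr ` PiE {1..n} (\<lambda>_. one_hot r ` {1..r})"
    then obtain t where t: "t \<in> PiE {1..n} (\<lambda>_. one_hot r ` {1..r})" "x = ?tr t" by auto
    then have "\<forall>i\<in>{1..n}. \<exists>k\<in>{1..r}. t i = one_hot r k" by blast
    then obtain w where w: "\<And>i. i \<in> {1..n} \<Longrightarrow> w i \<in> {1..r} \<and> t i = one_hot r (w i)"
      by metis
    have "x = word_question r n (restrict w {1..n})"
      using w by (auto simp: t(2) word_question_def one_hot_def fun_eq_iff restrict_def)
    moreover have "restrict w {1..n} \<in> words r n" using w by (auto simp: words_def)
    ultimately show "x \<in> word_question r n ` words r n" by blast
  qed
qed

lemma finite_words: "finite (words r n)"
  by (auto simp: words_def intro: finite_PiE)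

lemma card_words: "card (words r n) = r ^ n"
  by (simp add: words_def card_PiE)

lemma words_nonempty: "r \<ge> 1 \<Longrightarrow> words r n \<noteq> {}"
  using card_words[of r n] by (metis card.empty not_one_le_zero power_eq_0_iff)

section \<open>Values of finite games and of their repetitions\<close>

lemma finite_strategies:
  assumes "valid_game G"
  shows "finite (strategies G)"
  unfolding strategies_def
  using assms by (intro finite_PiE) (auto simp: valid_game_def valid_question_set_def)

lemma strategies_nonempty:
  assumes "valid_game G"
  shows "strategies G \<noteq> {}"
  using assms by (auto simp: strategies_def valid_game_def PiE_eq_empty_iff)

lemma valid_power_question_set:
  assumes Q: "valid_question_set Q"
  shows "valid_question_set (power_question_set Q n)"
proof -
  let ?P = "power_question_set Q n"
  have P: "provers ?P = provers Q" "\<And>j. questions ?P j = PiE {1..n} (\<lambda>_. questions Q j)"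
    "qtuples ?P = (\<lambda>t. \<lambda>j\<in>{1..provers Q}. \<lambda>i\<in>{1..n}. t i j) ` PiE {1..n} (\<lambda>_. qtuples Q)"
    by (simp_all add: power_question_set_def)
  have "\<exists>q\<in>qtuples ?P. q j = x"
    if j: "j \<in> {1..provers Q}" and x: "x \<in> PiE {1..n} (\<lambda>_. questions Q j)" for j x
  proof -
    have "\<forall>i\<in>{1..n}. \<exists>q\<in>qtuples Q. q j = x i"
      using Q j x unfolding valid_question_set_def by blast
    then obtain t where t: "\<And>i. i \<in> {1..n} \<Longrightarrow> t i \<in> qtuples Q \<and> t i j = x i" by metis
    \<comment> \<open>\<open>t\<close> is known only on \<open>{1..n}\<close>; the restriction makes
      it extensional, as membership in the product requires.\<close>
    let ?q = "\<lambda>j\<in>{1..provers Q}. \<lambda>i\<in>{1..n}. restrict t {1..n} i j"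
    have "?q \<in> qtuples ?P"
      unfolding P by (rule imageI) (use t in \<open>auto simp: restrict_PiE_iff\<close>)
    moreover have "?q j = x"
      using t j PiE_arb[OF x] by (auto simp: fun_eq_iff restrict_def)
    ultimately show ?thesis by blast
  qed
  moreover have "qtuples ?P \<subseteq> PiE {1..provers Q} (questions ?P)"
  proof -
    have "t i j \<in> questions Q j"
      if "t \<in> PiE {1..n} (\<lambda>_. qtuples Q)" "i \<in> {1..n}" "j \<in> {1..provers Q}" for t i j
    proof -
      have "t i \<in> PiE {1..provers Q} (questions Q)"
        using Q that unfolding valid_question_set_def by blast
      then show ?thesis using that(3) by (rule PiE_mem)
    qed
    then show ?thesis unfolding P by (intro image_subsetI) (simp add: restrict_PiE_iff)
  qed
  moreover have "finite (questions ?P j)" if "j \<in> {1..provers Q}" for j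
    using Q that unfolding P valid_question_set_def by (intro finite_PiE) auto
  moreover have "finite (qtuples ?P)"
    using Q unfolding P valid_question_set_def by (intro finite_imageI finite_PiE) auto
  moreover have "qtuples ?P \<noteq> {}"
    using Q unfolding P valid_question_set_def by (simp add: PiE_eq_empty_iff)
  ultimately show ?thesis
    unfolding valid_question_set_def P(1,2) by simp
qed

lemma valid_parallel_repetition:
  assumes "valid_game G"
  shows "valid_game (parallel_repetition G n)"
proof -
  have eqs: "qset (parallel_repetition G n) = power_question_set (qset G) n"
    "provers (power_question_set (qset G) n) = provers (qset G)"
    "\<And>j. answers (parallel_repetition G n) j = PiE {1..n} (\<lambda>_. answers G j)"
    by (simp_all add: parallel_repetition_def power_question_set_def)
  have "valid_question_set (power_question_set (qset G) n)"
    using assms valid_power_question_set unfolding valid_game_def by blast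
  moreover have "finite (PiE {1..n} (\<lambda>_. answers G j)) \<and> PiE {1..n} (\<lambda>_. answers G j) \<noteq> {}"
    if "j \<in> {1..provers (qset G)}" for j
    using assms that unfolding valid_game_def by (auto simp: PiE_eq_empty_iff intro!: finite_PiE)
  ultimately show ?thesis unfolding valid_game_def eqs by blast
qed

lemma success_prob_le_game_value:
  assumes "valid_game G" "s \<in> strategies G"
  shows "success_prob G s \<le> game_value G"
  unfolding game_value_def
  by (intro Max_ge finite_imageI finite_strategies imageI assms)

lemma game_value_attained:
  assumes "valid_game G"
  obtains s where "s \<in> strategies G" "success_prob G s = game_value G"
proof -
  have "game_value G \<in> success_prob G ` strategies G"
    unfolding game_value_def using assms finite_strategies strategies_nonempty
    by (intro Max_in) auto
  then show ?thesis using that by auto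
qed

lemma game_value_le_1:
  assumes "valid_game G"
  shows "game_value G \<le> 1"
proof -
  obtain s where "success_prob G s = game_value G" using game_value_attained[OF assms] .
  moreover have "success_prob G s \<le> 1" by (simp add: success_prob_def)
  ultimately show ?thesis by simp
qed

text \<open>The uniform distribution gives every question tuple positive mass, so an event of
  probability 1 misses none of them.\<close>

lemma perfect_strategy_accepts:
  assumes "valid_game G" "success_prob G s = 1" "q \<in> qtuples (qset G)"
  shows "verdict G q (\<lambda>j\<in>{1..provers (qset G)}. s j (q j))"
proof -
  have "finite (qtuples (qset G))" "qtuples (qset G) \<noteq> {}"
    using assms by (auto simp: valid_game_def valid_question_set_def)
  moreover have "AE q in measure_pmf (pmf_of_set (qtuples (qset G))).
      q \<in> {q. verdict G q (\<lambda>j\<in>{1..provers (qset G)}. s j (q j))}"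
    using assms(2) unfolding success_prob_def
    by (subst (asm) measure_pmf.prob_eq_1) auto
  ultimately show ?thesis using assms(3) by (auto simp: AE_measure_pmf_iff)
qed

section \<open>From perfect strategies to combinatorial lines\<close>

text \<open>
  The hypothesis \<open>agree\<close> is all that remains of a perfect strategy: prover \<open>j\<close> receives \<open>0\<close>
  on both the \<open>k\<close>-th and the \<open>l\<close>-th question tuple. A third letter exists because \<open>r \<ge> 3\<close>.
\<close>

lemma comb_line_of_agreeing_words:
  assumes r: "r \<ge> 3"
    and w: "\<And>k. k \<in> {1..r} \<Longrightarrow> w k \<in> words r n"
    and agree: "\<And>k l j m. \<lbrakk>k \<in> {1..r}; l \<in> {1..r}; j \<in> {1..r} - {k, l}; m \<in> {1..n}\<rbrakk>
      \<Longrightarrow> w k m = j \<longleftrightarrow> w l m = j"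
    and i: "i \<in> {1..n}" "\<And>k. k \<in> {1..r} \<Longrightarrow> w k i = k"
  shows "\<exists>b\<in>patterns r n. comb_line r n b = w ` {1..r}"
proof -
  have third: "\<exists>l\<in>{1..r}. l \<noteq> j \<and> l \<noteq> p" for j p
  proof -
    have "card ({1..r} - {j, p}) \<ge> card {1..r} - card {j, p}" by (rule diff_card_le_card_Diff) simp
    moreover have "card {j, p} \<le> 2" by (simp add: card_insert_if)
    ultimately have "card ({1..r} - {j, p}) > 0" using r by simp
    then show ?thesis by (auto simp: card_gt_0_iff)
  qed
  have rng: "w k m \<in> {1..r}" if "k \<in> {1..r}" "m \<in> {1..n}" for k m
    using w[OF that(1)] that(2) by (auto simp: words_def)
  \<comment> \<open>A position where one word deviates from its own index is fixed along the line.
    The deviating letter \<open>j\<close> spreads from \<open>w k\<close> to every word except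
    possibly \<open>w j\<close>, which needs a separate argument.\<close>
  have const: "w l m = w k m"
    if k: "k \<in> {1..r}" and l: "l \<in> {1..r}" and m: "m \<in> {1..n}" and ne: "w k m \<noteq> k" for k l m
  proof -
    define j where "j = w k m"
    have j: "j \<in> {1..r}" using rng k m by (simp add: j_def)
    have other: "w l' m = j" if "l' \<in> {1..r}" "l' \<noteq> j" for l'
      using agree[of k l' j m] k that j m ne by (auto simp: j_def)
    have "w j m = j"
    proof (rule ccontr)
      assume p: "w j m \<noteq> j"
      \<comment> \<open>If \<open>w j\<close> showed \<open>p\<close> instead of \<open>j\<close>,
        then \<open>agree\<close> for the letter \<open>p\<close> would carry \<open>p\<close> over
        to \<open>w l'\<close>, where \<open>other\<close> has already put \<open>j\<close>.\<close>
      obtain l' where l': "l' \<in> {1..r}" "l' \<noteq> j" "l' \<noteq> w j m" using third by metis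
      have "w l' m = w j m" using agree[of j l' "w j m" m] l' p j m rng[OF j m] by auto
      with other l' p show False by simp
    qed
    with other l have "w l m = j" by (cases "l = j") auto
    then show ?thesis by (simp add: j_def)
  qed
  \<comment> \<open>Wherever the wildcard is not placed, \<open>const\<close> makes all words equal,
    so \<open>w 1\<close> can stand for any of them.\<close>
  define b where "b = (\<lambda>m\<in>{1..n}. if \<forall>k\<in>{1..r}. w k m = k then None else Some (w 1 m))"
  have one: "1 \<in> {1..r}" using r by auto
  have "b i = None" using i by (simp add: b_def)
  then have "b \<notin> PiE {1..n} (\<lambda>_. Some ` {1..r})" using i(1) by (metis PiE_mem imageE option.distinct(1))
  moreover have "b \<in> PiE {1..n} (\<lambda>_. insert None (Some ` {1..r}))"
    using rng[OF one] unfolding b_def by auto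
  ultimately have "b \<in> patterns r n" by (simp add: patterns_def)
  moreover have "fill n b k = w k" if k: "k \<in> {1..r}" for k
  proof
    fix m show "fill n b k m = w k m"
    proof (cases "m \<in> {1..n}")
      case True
      show ?thesis
      proof (cases "\<forall>k\<in>{1..r}. w k m = k")
        case False
        then obtain k' where "k' \<in> {1..r}" "w k' m \<noteq> k'" by auto
        then have "w 1 m = w k m" using const[of k' 1 m] const[of k' k m] one k True by simp
        with False True show ?thesis by (auto simp: fill_def b_def)
      qed (use True k in \<open>auto simp: fill_def b_def\<close>)
    next
      case False
      then show ?thesis using w[OF k] by (auto simp: fill_def words_def PiE_def extensional_def)
    qed
  qed
  then have "comb_line r n b = w ` {1..r}" by (simp add: comb_line_def)
  ultimately show ?thesis by blast
qed

lemma line_game_nontrivial: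
  assumes r: "r \<ge> 3" and n: "n \<ge> 1" and S: "S \<subseteq> words r n" and lf: "line_free r n S"
  shows "\<not> trivial_game (line_game r n S)"
proof
  let ?G = "line_game r n S"
  assume "trivial_game ?G"
  moreover have valid: "valid_game ?G" using r n by (intro valid_line_game) auto
  ultimately obtain s where s: "success_prob ?G s = 1"
    using game_value_attained unfolding trivial_game_def by metis
  have "\<exists>w\<in>S. \<exists>i\<in>{1..n}. \<forall>j\<in>{1..r}.
      s j (if j = k then 1 else 0) = level_answer n i {m. w m = j} \<and> (j = k \<longleftrightarrow> w i = j)"
    if "k \<in> {1..r}" for k
  proof -
    have "one_hot r k \<in> qtuples (qset ?G)" using that by (auto simp: qtuples_one_hot)
    from perfect_strategy_accepts[OF valid s this] obtain w i where w: "w \<in> S" and i: "i \<in> {1..n}"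
      and ans: "\<And>j. j \<in> {1..r} \<Longrightarrow> s j (one_hot r k j) = level_answer n i {m. w m = j}
        \<and> (one_hot r k j = 1 \<longleftrightarrow> w i = j)"
      by auto
    have "s j (if j = k then 1 else 0) = level_answer n i {m. w m = j} \<and> (j = k \<longleftrightarrow> w i = j)"
      if "j \<in> {1..r}" for j
      using ans[OF that] that by (auto simp: one_hot_def split: if_splits)
    with w i show ?thesis by blast
  qed
  then have "\<forall>k\<in>{1..r}. \<exists>w i. w \<in> S \<and> i \<in> {1..n} \<and> (\<forall>j\<in>{1..r}.
      s j (if j = k then 1 else 0) = level_answer n i {m. w m = j} \<and> (j = k \<longleftrightarrow> w i = j))"
    by blast
  then obtain w i where wi: "\<And>k. k \<in> {1..r} \<Longrightarrow> w k \<in> S \<and> i k \<in> {1..n} \<and> (\<forall>j\<in>{1..r}.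
      s j (if j = k then 1 else 0) = level_answer n (i k) {m. w k m = j} \<and> (j = k \<longleftrightarrow> w k (i k) = j))"
    by metis
  \<comment> \<open>Prover \<open>j\<close> receives 0 on both tuples and so sends the same answer,
    from which the coordinate and the level set can be decoded.\<close>
  have same: "i k = i l \<and> {m. w k m = j} \<inter> {1..n} = {m. w l m = j} \<inter> {1..n}"
    if "k \<in> {1..r}" "l \<in> {1..r}" "j \<in> {1..r} - {k, l}" for k l j
  proof -
    have "level_answer n (i k) {m. w k m = j} = s j 0"
      using wi[of k] that by auto
    also have "\<dots> = level_answer n (i l) {m. w l m = j}"
      using wi[of l] that by auto
    finally show ?thesis by (simp add: level_answer_eq_iff)
  qed
  have one: "1 \<in> {1..r}" using r by simp
  have ieq: "i k = i 1" if k: "k \<in> {1..r}" for k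
  proof -
    \<comment> \<open>A prover other than \<open>k\<close> and \<open>1\<close>, whose common answer
      ties \<open>i k\<close> to \<open>i 1\<close>.\<close>
    have "(if k = 2 then 3 else 2) \<in> {1..r} - {k, 1}" using r by auto
    from same[OF k one this] show ?thesis by simp
  qed
  have "\<exists>b\<in>patterns r n. comb_line r n b = w ` {1..r}"
  proof (rule comb_line_of_agreeing_words[OF r])
    show "w k \<in> words r n" if "k \<in> {1..r}" for k using wi[OF that] S by auto
    show "w k m = j \<longleftrightarrow> w l m = j"
      if "k \<in> {1..r}" "l \<in> {1..r}" "j \<in> {1..r} - {k, l}" "m \<in> {1..n}" for k l j m
      using same[OF that(1-3)] that(4) by blast
    show "i 1 \<in> {1..n}" using wi[OF one] by simp
    show "w k (i 1) = k" if "k \<in> {1..r}" for k using wi[OF that] ieq[OF that] that by metis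
  qed
  moreover have "w ` {1..r} \<subseteq> S" using wi by auto
  ultimately show False using lf unfolding line_free_def by metis
qed

section \<open>The density bound in the repeated game, and the conclusion\<close>

lemma word_density_le_game_value:
  assumes r: "r \<ge> 2" and n: "n \<ge> 1" and S: "S \<subseteq> words r n"
  shows "word_density r n S \<le> game_value (parallel_repetition (line_game r n S) n)"
proof -
  let ?G = "line_game r n S"
  let ?P = "parallel_repetition ?G n"
  let ?T = "qtuples (power_question_set (one_hot_questions r) n)"
  \<comment> \<open>The answer in copy \<open>i\<close> uses the prover's questions from all copies,
    which only a strategy for the repeated game can do.\<close>
  define s where "s = (\<lambda>j\<in>{1..r}. \<lambda>x\<in>PiE {1..n} (\<lambda>_. {0, 1::nat}).
      \<lambda>i\<in>{1..n}. level_answer n i {m\<in>{1..n}. x m = 1})"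
  have valid: "valid_game ?P"
    using r n by (intro valid_parallel_repetition valid_line_game) auto
  have "level_answer n i {m\<in>{1..n}. x m = 1} \<in> answers ?G j" if "i \<in> {1..n}"
    for i j and x :: "nat \<Rightarrow> nat"
    unfolding line_game_simps
    by (rule image_eqI[of _ _ "(i, {m\<in>{1..n}. x m = 1})"]) (use that in auto)
  then have s: "s \<in> strategies ?P"
    by (simp add: strategies_def parallel_repetition_def power_question_set_def s_def restrict_PiE_iff
        del: line_game_simps(2))
  let ?E = "{q. verdict ?P q (\<lambda>j\<in>{1..provers (qset ?P)}. s j (q j))}"
  have bij: "bij_betw (word_question r n) (words r n) ?T" by (rule bij_betw_word_question)
  \<comment> \<open>The count \<open>r ^ n\<close> makes the denominator of the winning probability
    that of \<open>word_density\<close>.\<close>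
  have T: "finite ?T" "?T \<noteq> {}" "card ?T = r ^ n"
    using bij bij_betw_finite[OF bij] finite_words words_nonempty[of r n] r
      bij_betw_same_card[OF bij] card_words by (auto simp: bij_betw_def)
  have win: "word_question r n w \<in> ?E" if w: "w \<in> S" for w
  proof -
    have ans: "s j (word_question r n w j) i = level_answer n i {m. w m = j}"
      if "j \<in> {1..r}" "i \<in> {1..n}" for i j
      using that by (auto simp: s_def word_question_def level_answer_eq_iff)
    \<comment> \<open>One word \<open>w\<close> serves as witness in every copy, and each copy names
      its own index.\<close>
    have "\<exists>w'\<in>S. \<exists>i'\<in>{1..n}. \<forall>j\<in>{1..r}.
        s j (word_question r n w j) i = level_answer n i' {m. w' m = j}
        \<and> (word_question r n w j i = 1 \<longleftrightarrow> w' i' = j)" if i: "i \<in> {1..n}" for i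
      using w i ans by (intro bexI[of _ w] bexI[of _ i]) (auto simp: word_question_def)
    then show ?thesis
      by (simp add: parallel_repetition_def power_question_set_def)
  qed
  have "card S = card (word_question r n ` S)"
    using bij S by (metis bij_betw_def card_image inj_on_subset)
  also have "\<dots> \<le> card (?T \<inter> ?E)"
    using T(1) win bij S by (intro card_mono) (auto simp: bij_betw_def)
  finally have "word_density r n S \<le> real (card (?T \<inter> ?E)) / real (card ?T)"
    unfolding word_density_def T(3) by (simp add: divide_right_mono)
  also have "\<dots> = success_prob ?P s"
    unfolding success_prob_def using T(1,2)
    by (subst measure_pmf_of_set) (auto simp: parallel_repetition_def)
  also have "\<dots> \<le> game_value ?P"
    by (rule success_prob_le_game_value[OF valid s])
  finally show ?thesis .
qed

theorem theorem1p8: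
  fixes r n :: nat
  assumes "r \<ge> 3" and "n \<ge> 1"
  shows "omega_DHJ r n \<le> omega_rep (one_hot_questions r) n"
proof -
  let ?D = "{word_density r n S | S. S \<subseteq> words r n \<and> line_free r n S}"
  have "?D \<subseteq> word_density r n ` Pow (words r n)" by auto
  then have "finite ?D" using finite_words by (meson finite_Pow_iff finite_imageI finite_subset)
  \<comment> \<open>Lines are nonempty, so the empty set contains none and the maximum is taken over
    a nonempty set.\<close>
  moreover have "line_free r n {}" using assms by (auto simp: line_free_def comb_line_def)
  then have "?D \<noteq> {}" by blast
  ultimately have "omega_DHJ r n \<in> ?D" unfolding omega_DHJ_def by (rule Max_in)
  then obtain S where S: "S \<subseteq> words r n" "line_free r n S" "omega_DHJ r n = word_density r n S"
    by auto
  let ?V = "{game_value (parallel_repetition G n) | G :: (nat, nat) game.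
            valid_game G \<and> qset G = one_hot_questions r \<and> \<not> trivial_game G}"
  have "game_value (parallel_repetition (line_game r n S) n) \<in> ?V"
  proof (intro CollectI exI conjI)
    show "valid_game (line_game r n S)" using assms by (intro valid_line_game) auto
    show "\<not> trivial_game (line_game r n S)" using assms S by (intro line_game_nontrivial)
  qed simp_all
  \<comment> \<open>A real \<open>Sup\<close> is known to dominate its members only when the set is
    bounded above; values are probabilities, so 1 is a bound.\<close>
  moreover have "bdd_above ?V"
    using game_value_le_1[OF valid_parallel_repetition] by (intro bdd_aboveI[of _ 1]) blast
  ultimately have "game_value (parallel_repetition (line_game r n S) n)
      \<le> omega_rep (one_hot_questions r) n"
    unfolding omega_rep_def by (intro cSup_upper)
  moreover have "omega_DHJ r n \<le> game_value (parallel_repetition (line_game r n S) n)"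
    using word_density_le_game_value[of r n S] assms S by simp
  ultimately show ?thesis by linarith
qed

end
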